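(* Let $\mathcal{C}$ be a locally small category and let $\mathcal{S}et$ be the category of sets. Let $A$ be an object of $\mathcal{C}$, let $h^A(-)=\hom_{\mathcal{C}}(-,A):\mathcal{C}\to\mathcal{S}et$ be the corresponding representable contravariant functor, and let $F^*:\mathcal{C}\to\mathcal{S}et$ be another contravariant functor. For each object $X$ of $\mathcal{C}$ define $$\mathcal{I}m_{F^*}: h^A(X)\to \mathcal{S}ub F^*(X),\qquad \mathcal{I}m_{F^*}(f):=f^*(F^*(A))=\{f^*\alpha \mid \alpha\in F^*(A)\}\subset F^*(X).$$ Then these maps form a natural transformation $$\mathcal{I}m_{F^*}: h^A(-)\to \mathcal{S}ub F^*(-)$$ of contravariant functors $\mathcal{C}\to\mathcal{S}et$. Moreover, for every object $X$ of $\mathcal{C}$ and every $f\in h^A(X)$, the set $\mathcal{I}m_{F^*}(f)$ is the set consisting of the images of $f$ under all the natural transformations from $h^A$ to $F^*$, i.e. $$\mathcal{I}m_{F^*}(f)=\{\tau_X(f) \mid \tau: h^A\to F^* \text{ a natural transformation}\}.$$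
   Context: Locally small means that $\hom_{\mathcal{C}}(X,Y)$ is a set for all objects $X,Y$ of $\mathcal{C}$. For a morphism $f:X\to Y$ in $\mathcal{C}$, $f^*:F^*(Y)\to F^*(X)$ denotes the map $F^*(f)$ induced by the contravariant functor $F^*$. For a set $G$, $\mathcal{S}ub(G)$ denotes the set of all subsets of $G$. The "subset" functor $\mathcal{S}ub F^*:\mathcal{C}\to\mathcal{S}et$ associated to $F^*$ is the contravariant functor given on objects by $\mathcal{S}ub F^*(X):=\mathcal{S}ub(F^*(X))$ and sending a morphism $g:X\to Y$ to the direct-image map $g^*:\mathcal{S}ub(F^*(Y))\to\mathcal{S}ub(F^*(X))$, $S\mapsto g^*(S)=\{g^*s\mid s\in S\}$. For a natural transformation $\tau:h^A\to F^*$, $\tau_X:h^A(X)\to F^*(X)$ denotes its component at $X$. *)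

theory Defs
  imports "HOL-Library.FuncSet"
begin

text \<open>
  Hom-collections are sets by construction, which is local smallness. Hom-sets for different
  pairs of objects may overlap (as they do for extensional functions between sets), so
  composition and the morphism part of a functor take the objects as arguments:
  \<open>Cmp C X Y Z g f\<close> is the composite of \<open>f : X \<rightarrow> Y\<close> and \<open>g : Y \<rightarrow> Z\<close>.
\<close>

record ('o, 'm) cat =
  Obj :: "'o set"
  Hom :: "'o \<Rightarrow> 'o \<Rightarrow> 'm set"
  Cmp :: "'o \<Rightarrow> 'o \<Rightarrow> 'o \<Rightarrow> 'm \<Rightarrow> 'm \<Rightarrow> 'm"
  Idt :: "'o \<Rightarrow> 'm"

locale category =
  fixes C :: "('o, 'm) cat"
  assumes Idt_in_Hom: "X \<in> Obj C \<Longrightarrow> Idt C X \<in> Hom C X X"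
    and Cmp_in_Hom: "\<lbrakk>X \<in> Obj C; Y \<in> Obj C; Z \<in> Obj C; f \<in> Hom C X Y; g \<in> Hom C Y Z\<rbrakk>
      \<Longrightarrow> Cmp C X Y Z g f \<in> Hom C X Z"
    and Cmp_Idt_right: "\<lbrakk>X \<in> Obj C; Y \<in> Obj C; f \<in> Hom C X Y\<rbrakk>
      \<Longrightarrow> Cmp C X X Y f (Idt C X) = f"
    and Cmp_Idt_left: "\<lbrakk>X \<in> Obj C; Y \<in> Obj C; f \<in> Hom C X Y\<rbrakk>
      \<Longrightarrow> Cmp C X Y Y (Idt C Y) f = f"
    and Cmp_assoc: "\<lbrakk>W \<in> Obj C; X \<in> Obj C; Y \<in> Obj C; Z \<in> Obj C;
        f \<in> Hom C W X; g \<in> Hom C X Y; h \<in> Hom C Y Z\<rbrakk>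
      \<Longrightarrow> Cmp C W Y Z h (Cmp C W X Y g f) = Cmp C W X Z (Cmp C X Y Z h g) f"

definition set_cat :: "('a set, 'a \<Rightarrow> 'a) cat" where
  "set_cat = \<lparr>
     Obj = UNIV,
     Hom = (\<lambda>S T. S \<rightarrow>\<^sub>E T),
     Cmp = (\<lambda>S T U g f. compose S g f),
     Idt = (\<lambda>S. \<lambda>x\<in>S. x)\<rparr>"

lemma category_set_cat: "category set_cat"
  by unfold_locales
    (auto simp: set_cat_def compose_def PiE_iff extensional_def restrict_def fun_eq_iff)

text \<open>For \<open>f : X \<rightarrow> Y\<close>, the induced morphism \<open>F(Y) \<rightarrow> F(X)\<close> is \<open>on_hom F X Y f\<close>.\<close>

record ('o, 'm, 'p, 'n) functor_data =
  on_obj :: "'o \<Rightarrow> 'p"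
  on_hom :: "'o \<Rightarrow> 'o \<Rightarrow> 'm \<Rightarrow> 'n"

locale contravariant_functor =
  source: category C + target: category D
  for C :: "('o, 'm) cat" and D :: "('p, 'n) cat" +
  fixes F :: "('o, 'm, 'p, 'n) functor_data"
  assumes on_obj_in_Obj: "X \<in> Obj C \<Longrightarrow> on_obj F X \<in> Obj D"
    and on_hom_in_Hom: "\<lbrakk>X \<in> Obj C; Y \<in> Obj C; f \<in> Hom C X Y\<rbrakk>
      \<Longrightarrow> on_hom F X Y f \<in> Hom D (on_obj F Y) (on_obj F X)"
    and on_hom_Idt: "X \<in> Obj C \<Longrightarrow> on_hom F X X (Idt C X) = Idt D (on_obj F X)"
    and on_hom_Cmp: "\<lbrakk>X \<in> Obj C; Y \<in> Obj C; Z \<in> Obj C; f \<in> Hom C X Y; g \<in> Hom C Y Z\<rbrakk>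
      \<Longrightarrow> on_hom F X Z (Cmp C X Y Z g f)
        = Cmp D (on_obj F Z) (on_obj F Y) (on_obj F X) (on_hom F X Y f) (on_hom F Y Z g)"

text \<open>
  Natural transformations between contravariant set-valued functors. The values of the two
  functors may have different element types, because the functors \<open>Hom(-, A)\<close>, \<open>F\<close> and
  \<open>Sub F\<close> do.
\<close>

locale natural_transformation =
  dom_functor: contravariant_functor C set_cat F + cod_functor: contravariant_functor C set_cat G
  for C :: "('o, 'm) cat"
    and F :: "('o, 'm, 'a set, 'a \<Rightarrow> 'a) functor_data"
    and G :: "('o, 'm, 'b set, 'b \<Rightarrow> 'b) functor_data" +
  fixes \<tau> :: "'o \<Rightarrow> 'a \<Rightarrow> 'b"
  assumes component: "X \<in> Obj C \<Longrightarrow> \<tau> X \<in> on_obj F X \<rightarrow>\<^sub>E on_obj G X"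
    and naturality: "\<lbrakk>X \<in> Obj C; Y \<in> Obj C; f \<in> Hom C X Y\<rbrakk>
      \<Longrightarrow> compose (on_obj F Y) (\<tau> X) (on_hom F X Y f)
        = compose (on_obj F Y) (on_hom G X Y f) (\<tau> Y)"

definition hom_functor ::
  "('o, 'm) cat \<Rightarrow> 'o \<Rightarrow> ('o, 'm, 'm set, 'm \<Rightarrow> 'm) functor_data" where
  "hom_functor C A = \<lparr>
     on_obj = (\<lambda>X. Hom C X A),
     on_hom = (\<lambda>X Y g. \<lambda>f \<in> Hom C Y A. Cmp C X Y A f g)\<rparr>"

definition sub_functor ::
  "('o, 'm, 'a set, 'a \<Rightarrow> 'a) functor_data
    \<Rightarrow> ('o, 'm, 'a set set, 'a set \<Rightarrow> 'a set) functor_data" where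
  "sub_functor F = \<lparr>
     on_obj = (\<lambda>X. Pow (on_obj F X)),
     on_hom = (\<lambda>X Y g. \<lambda>S \<in> Pow (on_obj F Y). on_hom F X Y g ` S)\<rparr>"

definition Im_transf ::
  "('o, 'm) cat \<Rightarrow> 'o \<Rightarrow> ('o, 'm, 'a set, 'a \<Rightarrow> 'a) functor_data
    \<Rightarrow> 'o \<Rightarrow> 'm \<Rightarrow> 'a set" where
  "Im_transf C A F X = (\<lambda>f \<in> on_obj (hom_functor C A) X. on_hom F X A f ` on_obj F A)"

end

theory Submission
  imports Defs
begin

text \<open>
  The heart of the matter is the Yoneda lemma. A natural transformation
  \<open>\<tau> : Hom(-, A) \<rightarrow> F\<close> is determined by the element \<open>\<alpha> = \<tau>\<^sub>A(id\<^sub>A)\<close> of \<open>F(A)\<close>, because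
  naturality along \<open>f : X \<rightarrow> A\<close>, evaluated at \<open>id\<^sub>A\<close>, reads \<open>\<tau>\<^sub>X(f) = f\<^sup>*\<alpha>\<close>
  (\<open>natural_from_hom_apply\<close>); conversely every \<open>\<alpha> \<in> F(A)\<close> defines such a transformation by
  this formula (\<open>yoneda_natural\<close>). For a fixed \<open>f\<close>, the values \<open>\<tau>\<^sub>X(f)\<close> therefore range over
  exactly the elements \<open>f\<^sup>*\<alpha>\<close> with \<open>\<alpha> \<in> F(A)\<close>, and these form the image of \<open>f\<^sup>*\<close>.

  Naturality of the image itself is functoriality of \<open>F\<close>: for \<open>g : X \<rightarrow> Y\<close> and
  \<open>f : Y \<rightarrow> A\<close>, the image of \<open>(f \<circ> g)\<^sup>* = g\<^sup>* \<circ> f\<^sup>*\<close> is the direct image under \<open>g\<^sup>*\<close> of the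
  image of \<open>f\<^sup>*\<close> (\<open>Im_transf_natural\<close>).
\<close>

text \<open>
  Morphisms of \<open>set_cat\<close> are extensional functions, so an equation between two of them amounts
  to equality of their values on the domain. Working with values avoids the composition operator
  of extensional functions in all later calculations.
\<close>

lemma set_functorI:
  assumes "category C"
    and maps: "\<And>X Y g. \<lbrakk>X \<in> Obj C; Y \<in> Obj C; g \<in> Hom C X Y\<rbrakk>
      \<Longrightarrow> on_hom F X Y g \<in> on_obj F Y \<rightarrow>\<^sub>E on_obj F X"
    and id: "\<And>X x. \<lbrakk>X \<in> Obj C; x \<in> on_obj F X\<rbrakk> \<Longrightarrow> on_hom F X X (Idt C X) x = x"
    and comp: "\<And>X Y Z f g x. \<lbrakk>X \<in> Obj C; Y \<in> Obj C; Z \<in> Obj C;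
        f \<in> Hom C X Y; g \<in> Hom C Y Z; x \<in> on_obj F Z\<rbrakk>
      \<Longrightarrow> on_hom F X Z (Cmp C X Y Z g f) x = on_hom F X Y f (on_hom F Y Z g x)"
  shows "contravariant_functor C set_cat F"
proof -
  interpret category C by fact
  interpret S: category set_cat by (rule category_set_cat)
  show ?thesis
  proof
    fix X assume X: "X \<in> Obj C"
    have "on_hom F X X (Idt C X) = (\<lambda>x\<in>on_obj F X. x)"
      using maps[OF X X Idt_in_Hom[OF X]] id[OF X]
      by (intro extensionalityI[of _ "on_obj F X"]) (auto simp: PiE_iff)
    then show "on_hom F X X (Idt C X) = Idt set_cat (on_obj F X)"
      by (simp add: set_cat_def)
  next
    fix X Y Z f g
    assume *: "X \<in> Obj C" "Y \<in> Obj C" "Z \<in> Obj C" "f \<in> Hom C X Y" "g \<in> Hom C Y Z"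
    have "on_hom F X Z (Cmp C X Y Z g f)
        = compose (on_obj F Z) (on_hom F X Y f) (on_hom F Y Z g)"
      using maps[OF *(1,3) Cmp_in_Hom[OF *]] comp[OF *]
      by (intro extensionalityI[of _ "on_obj F Z"]) (auto simp: PiE_iff compose_eq)
    then show "on_hom F X Z (Cmp C X Y Z g f)
        = Cmp set_cat (on_obj F Z) (on_obj F Y) (on_obj F X) (on_hom F X Y f) (on_hom F Y Z g)"
      by (simp add: set_cat_def)
  qed (simp_all add: set_cat_def maps)
qed

context
  fixes C :: "('o, 'm) cat" and F :: "('o, 'm, 'a set, 'a \<Rightarrow> 'a) functor_data"
  assumes F: "contravariant_functor C set_cat F"
begin

interpretation contravariant_functor C set_cat F by (rule F)

lemma set_functor_maps:
  "\<lbrakk>X \<in> Obj C; Y \<in> Obj C; g \<in> Hom C X Y\<rbrakk>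
    \<Longrightarrow> on_hom F X Y g \<in> on_obj F Y \<rightarrow>\<^sub>E on_obj F X"
  using on_hom_in_Hom by (simp add: set_cat_def)

lemma set_functor_id:
  "\<lbrakk>X \<in> Obj C; x \<in> on_obj F X\<rbrakk> \<Longrightarrow> on_hom F X X (Idt C X) x = x"
  by (simp add: on_hom_Idt set_cat_def)

lemma set_functor_comp:
  "\<lbrakk>X \<in> Obj C; Y \<in> Obj C; Z \<in> Obj C; f \<in> Hom C X Y; g \<in> Hom C Y Z; x \<in> on_obj F Z\<rbrakk>
    \<Longrightarrow> on_hom F X Z (Cmp C X Y Z g f) x = on_hom F X Y f (on_hom F Y Z g x)"
  by (simp add: on_hom_Cmp set_cat_def compose_eq)

end

lemma natural_transformationI:
  assumes "contravariant_functor C set_cat F" and "contravariant_functor C set_cat G"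
    and "\<And>X. X \<in> Obj C \<Longrightarrow> \<tau> X \<in> on_obj F X \<rightarrow>\<^sub>E on_obj G X"
    and "\<And>X Y g x. \<lbrakk>X \<in> Obj C; Y \<in> Obj C; g \<in> Hom C X Y; x \<in> on_obj F Y\<rbrakk>
      \<Longrightarrow> \<tau> X (on_hom F X Y g x) = on_hom G X Y g (\<tau> Y x)"
  shows "natural_transformation C F G \<tau>"
  unfolding natural_transformation_def natural_transformation_axioms_def
  using assms by (auto simp: compose_def restrict_def fun_eq_iff)

lemma natural_transformation_apply:
  assumes "natural_transformation C F G \<tau>"
    and "X \<in> Obj C" "Y \<in> Obj C" "g \<in> Hom C X Y" "x \<in> on_obj F Y"
  shows "\<tau> X (on_hom F X Y g x) = on_hom G X Y g (\<tau> Y x)"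
  using fun_cong[OF natural_transformation.naturality[OF assms(1-4)], of x] assms(5)
  by (simp add: compose_eq)

lemma hom_functor_contravariant:
  assumes "category C" and A: "A \<in> Obj C"
  shows "contravariant_functor C set_cat (hom_functor C A)"
proof -
  interpret category C by fact
  show ?thesis
    using A by (intro set_functorI)
      (auto simp: hom_functor_def category_axioms Cmp_in_Hom Cmp_Idt_right Cmp_assoc)
qed

lemma sub_functor_contravariant:
  assumes F: "contravariant_functor C set_cat F"
  shows "contravariant_functor C set_cat (sub_functor F)"
proof -
  interpret contravariant_functor C set_cat F by fact
  show ?thesis
  proof (rule set_functorI)
    show "category C" by (rule source.category_axioms)
  next
    fix X Y g assume *: "X \<in> Obj C" "Y \<in> Obj C" "g \<in> Hom C X Y"
    show "on_hom (sub_functor F) X Y g \<in> on_obj (sub_functor F) Y \<rightarrow>\<^sub>E on_obj (sub_functor F) X"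
      using PiE_mem[OF set_functor_maps[OF F *]] by (auto simp: sub_functor_def)
  next
    fix X S assume X: "X \<in> Obj C" and "S \<in> on_obj (sub_functor F) X"
    then have S: "S \<subseteq> on_obj F X" by (simp add: sub_functor_def)
    then have "on_hom F X X (Idt C X) ` S = (\<lambda>x. x) ` S"
      by (intro image_cong refl set_functor_id[OF F X]) auto
    with S show "on_hom (sub_functor F) X X (Idt C X) S = S"
      by (simp add: sub_functor_def)
  next
    fix X Y Z f g S
    assume *: "X \<in> Obj C" "Y \<in> Obj C" "Z \<in> Obj C" "f \<in> Hom C X Y" "g \<in> Hom C Y Z"
      and S: "S \<in> on_obj (sub_functor F) Z"
    have SZ: "S \<subseteq> on_obj F Z" using S by (simp add: sub_functor_def)
    then have "on_hom F Y Z g ` S \<subseteq> on_obj F Y"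
      using set_functor_maps[OF F *(2,3,5)] by (auto simp: PiE_iff)
    moreover have "on_hom F X Z (Cmp C X Y Z g f) ` S = on_hom F X Y f ` on_hom F Y Z g ` S"
      unfolding image_image using SZ by (intro image_cong refl set_functor_comp[OF F *]) auto
    ultimately show "on_hom (sub_functor F) X Z (Cmp C X Y Z g f) S
        = on_hom (sub_functor F) X Y f (on_hom (sub_functor F) Y Z g S)"
      using SZ by (simp add: sub_functor_def)
  qed
qed

lemma Im_transf_natural:
  assumes C: "category C" and A: "A \<in> Obj C" and F: "contravariant_functor C set_cat F"
  shows "natural_transformation C (hom_functor C A) (sub_functor F) (Im_transf C A F)"
proof (rule natural_transformationI)
  fix X assume X: "X \<in> Obj C"
  show "Im_transf C A F X \<in> on_obj (hom_functor C A) X \<rightarrow>\<^sub>E on_obj (sub_functor F) X"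
    using PiE_mem[OF set_functor_maps[OF F X A]]
    by (auto simp: Im_transf_def hom_functor_def sub_functor_def)
next
  fix X Y g f
  assume X: "X \<in> Obj C" and Y: "Y \<in> Obj C" and g: "g \<in> Hom C X Y"
    and "f \<in> on_obj (hom_functor C A) Y"
  then have f: "f \<in> Hom C Y A" by (simp add: hom_functor_def)
  have gf: "Cmp C X Y A f g \<in> Hom C X A"
    by (rule category.Cmp_in_Hom[OF C X Y A g f])
  have "on_hom F X A (Cmp C X Y A f g) ` on_obj F A
      = on_hom F X Y g ` on_hom F Y A f ` on_obj F A"
    unfolding image_image by (intro image_cong refl set_functor_comp[OF F X Y A g f])
  moreover have "on_hom F Y A f ` on_obj F A \<subseteq> on_obj F Y"
    using set_functor_maps[OF F Y A f] by (auto simp: PiE_iff)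
  ultimately show "Im_transf C A F X (on_hom (hom_functor C A) X Y g f)
      = on_hom (sub_functor F) X Y g (Im_transf C A F Y f)"
    using f gf by (simp add: Im_transf_def hom_functor_def sub_functor_def)
qed (fact hom_functor_contravariant[OF C A] sub_functor_contravariant[OF F])+

definition yoneda_transf ::
  "('o, 'm) cat \<Rightarrow> 'o \<Rightarrow> ('o, 'm, 'a set, 'a \<Rightarrow> 'a) functor_data
    \<Rightarrow> 'a \<Rightarrow> 'o \<Rightarrow> 'm \<Rightarrow> 'a" where
  "yoneda_transf C A F \<alpha> X = (\<lambda>f \<in> Hom C X A. on_hom F X A f \<alpha>)"

text \<open>
  Naturality holds because \<open>(f \<circ> g)\<^sup>*\<alpha> = g\<^sup>*(f\<^sup>*\<alpha>)\<close>. This is the existence half of the Yoneda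
  lemma.
\<close>

lemma yoneda_natural:
  assumes C: "category C" and A: "A \<in> Obj C" and F: "contravariant_functor C set_cat F"
    and \<alpha>: "\<alpha> \<in> on_obj F A"
  shows "natural_transformation C (hom_functor C A) F (yoneda_transf C A F \<alpha>)"
proof (rule natural_transformationI)
  fix X assume X: "X \<in> Obj C"
  show "yoneda_transf C A F \<alpha> X \<in> on_obj (hom_functor C A) X \<rightarrow>\<^sub>E on_obj F X"
    using PiE_mem[OF set_functor_maps[OF F X A] \<alpha>]
    by (auto simp: yoneda_transf_def hom_functor_def)
next
  fix X Y g f
  assume X: "X \<in> Obj C" and Y: "Y \<in> Obj C" and g: "g \<in> Hom C X Y"
    and "f \<in> on_obj (hom_functor C A) Y"
  then have f: "f \<in> Hom C Y A" by (simp add: hom_functor_def)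
  show "yoneda_transf C A F \<alpha> X (on_hom (hom_functor C A) X Y g f)
      = on_hom F X Y g (yoneda_transf C A F \<alpha> Y f)"
    using f category.Cmp_in_Hom[OF C X Y A g f] set_functor_comp[OF F X Y A g f \<alpha>]
    by (simp add: yoneda_transf_def hom_functor_def)
qed (fact hom_functor_contravariant[OF C A] F)+

text \<open>
  The uniqueness half of the Yoneda lemma: since \<open>f = id\<^sub>A \<circ> f\<close>, the element \<open>f\<close> of
  \<open>Hom(X, A)\<close> is the pullback of \<open>id\<^sub>A\<close> along \<open>f\<close>, and \<open>\<tau>\<close> commutes with pullbacks.
\<close>

lemma natural_from_hom_apply:
  assumes C: "category C" and A: "A \<in> Obj C" and X: "X \<in> Obj C" and f: "f \<in> Hom C X A"
    and \<tau>: "natural_transformation C (hom_functor C A) F \<tau>"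
  shows "\<tau> X f = on_hom F X A f (\<tau> A (Idt C A))"
proof -
  interpret category C by fact
  have id: "Idt C A \<in> on_obj (hom_functor C A) A"
    using Idt_in_Hom[OF A] by (simp add: hom_functor_def)
  have "on_hom (hom_functor C A) X A f (Idt C A) = f"
    using Idt_in_Hom[OF A] Cmp_Idt_left[OF X A f] by (simp add: hom_functor_def)
  then show ?thesis
    using natural_transformation_apply[OF \<tau> X A f id] by simp
qed

theorem mainTheorem1:
  fixes C :: "('o, 'm) cat"
    and A :: 'o
    and F :: "('o, 'm, 'a set, 'a \<Rightarrow> 'a) functor_data"
  assumes "category C"
    and "A \<in> Obj C"
    and "contravariant_functor C set_cat F"
  shows "natural_transformation C (hom_functor C A) (sub_functor F) (Im_transf C A F)
    \<and> (\<forall>X \<in> Obj C. \<forall>f \<in> on_obj (hom_functor C A) X.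
         Im_transf C A F X f
           = {\<tau> X f | \<tau>. natural_transformation C (hom_functor C A) F \<tau>})"
proof (intro conjI ballI)
  show "natural_transformation C (hom_functor C A) (sub_functor F) (Im_transf C A F)"
    by (rule Im_transf_natural[OF assms])
next
  fix X f assume X: "X \<in> Obj C" and fX: "f \<in> on_obj (hom_functor C A) X"
  then have f: "f \<in> Hom C X A" by (simp add: hom_functor_def)
  have Im: "Im_transf C A F X f = on_hom F X A f ` on_obj F A"
    using fX by (simp add: Im_transf_def)
  show "Im_transf C A F X f = {\<tau> X f | \<tau>. natural_transformation C (hom_functor C A) F \<tau>}"
  proof (intro equalityI subsetI)
    fix x assume "x \<in> Im_transf C A F X f"
    then obtain \<alpha> where \<alpha>: "\<alpha> \<in> on_obj F A" and x: "x = on_hom F X A f \<alpha>"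
      unfolding Im by blast
    have "x = yoneda_transf C A F \<alpha> X f"
      using f x by (simp add: yoneda_transf_def)
    then show "x \<in> {\<tau> X f | \<tau>. natural_transformation C (hom_functor C A) F \<tau>}"
      using yoneda_natural[OF assms \<alpha>] by blast
  next
    fix x assume "x \<in> {\<tau> X f | \<tau>. natural_transformation C (hom_functor C A) F \<tau>}"
    then obtain \<tau> where \<tau>: "natural_transformation C (hom_functor C A) F \<tau>" and x: "x = \<tau> X f"
      by blast
    have "\<tau> A (Idt C A) \<in> on_obj F A"
      using natural_transformation.component[OF \<tau> assms(2)]
        category.Idt_in_Hom[OF assms(1,2)]
      by (auto simp: hom_functor_def)
    then show "x \<in> Im_transf C A F X f"
      unfolding Im x natural_from_hom_apply[OF assms(1,2) X f \<tau>] by (rule imageI)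
  qed
qed

end
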